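(* Let $E$ be a quasi-Banach ideal space with the Fatou property over the counting measure space $(\mathbb N,2^{\mathbb N},m)$ such that $E\setminus l_\infty\ne\emptyset$, and let $\varphi$ be an Orlicz function with $a_\varphi<b_\varphi$ and $\alpha^E_\varphi>0$. (i) If $b_\varphi<\infty$, then $E_\varphi$ contains an order linearly isometric copy of $l_\infty$. (ii) Assume that $b_\varphi=\infty$ and there exist a number $d\in(0,1)$ and an increasing sequence of natural numbers $(i_j)_{j=1}^\infty$ such that $\lim_{j\to\infty}\|e(i_j)\|_E=0$ and $\frac{\|e(i_{j+1})\|_E}{\|e(i_j)\|_E}\ge d$ for each $j\in\mathbb N$, where $e(i)$ is the $i$-th unit vector. If $\varphi\notin\Delta_2(\infty)$, then $E_\varphi$ contains an order linearly isometric copy of $l_\infty$.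
   Context: $L^0$ is the space of all real sequences, with the coordinatewise order. A quasi-norm is a functional satisfying the axioms of a norm with the triangle inequality replaced by $\|x+y\|\le C(\|x\|+\|y\|)$ for some constant $C\ge1$. A quasi-Banach ideal space over $\mathbb N$ is a linear subspace $E\subset L^0$ with a complete quasi-norm $\|\cdot\|_E$ such that (i) $x\in L^0$, $y\in E$, $|x|\le|y|$ imply $x\in E$, $\|x\|_E\le\|y\|_E$; (ii) some $x\in E$ has all coordinates strictly positive. $E$ has the Fatou property if $0\le x_n\uparrow|x|$ coordinatewise, $x_n\in E$, $x\in L^0$, $\sup_n\|x_n\|_E<\infty$ imply $x\in E$ and $\|x_n\|_E\to\|x\|_E$. An Orlicz function is a non-decreasing $\varphi:[0,\infty)\to[0,\infty]$ with $\varphi(0)=0$, right continuous at $0$, continuous on $(0,b_\varphi)$ and left continuous at $b_\varphi$, where $b_\varphi=\sup\{u\ge0:\varphi(u)<\infty\}$, and with $\lim_{u\to\infty}\varphi(u)=\infty$. $a_\varphi=\sup\{u\ge0:\varphi(u)=0\}$. $\varphi\in\Delta_2(\infty)$ means: there are $K,u_0\in(0,\infty)$ with $\varphi(u_0)<\infty$ and $\varphi(2u)\le K\varphi(u)$ for all $u\ge u_0$. Indices: $\alpha^a_\varphi$ is the supremum of $p\in\mathbb R$ for which there is $K\ge1$ with $\varphi(au)\le Ka^p\varphi(u)$ for all $u\ge0$, $0<a\le1$; $\alpha^\infty_\varphi$ is the same with the inequality required only for $u\ge u_0$, for some $u_0>0$ with $\varphi(u_0)<\infty$. Here (as $E\not\subset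 l_\infty$) $\alpha^E_\varphi=\alpha^a_\varphi$ if $l_\infty\not\subset E$, and $\alpha^E_\varphi=\alpha^\infty_\varphi$ if $l_\infty\subset E$. $\rho^E_\varphi(x)=\|\varphi(|x|)\|_E$ if $\varphi(|x|)\in E$, and $=\infty$ otherwise; $E_\varphi=\{x\in L^0:\rho^E_\varphi(\lambda x)<\infty\text{ for some }\lambda>0\}$ with the quasi-norm $\|x\|_\varphi=\inf\{\lambda>0:\rho^E_\varphi(x/\lambda)\le1\}$. A quasi-normed ideal space $F$ contains an order linearly isometric copy of $l_\infty$ if there is a linear map $P:l_\infty\to F$ with $\|Pz\|_F=\|z\|_{l_\infty}$ and $|Pz|=P|z|$ for all $z\in l_\infty$ (in particular $Pz\ge0$ when $z\ge0$). *)

theory Defs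
  imports "HOL-Library.Extended_Nonnegative_Real"
begin

text \<open>
  The space of all real sequences is the type \<^typ>\<open>nat \<Rightarrow> real\<close>. A quasi-normed space of sequences
  is a pair of a carrier \<open>E\<close> and a function \<open>N\<close>; the values of \<open>N\<close> outside \<open>E\<close> are irrelevant.
\<close>

definition seq_subspace :: "(nat \<Rightarrow> real) set \<Rightarrow> bool" where
  "seq_subspace E \<longleftrightarrow>
     (\<lambda>i. 0) \<in> E \<and>
     (\<forall>x\<in>E. \<forall>y\<in>E. (\<lambda>i. x i + y i) \<in> E) \<and>
     (\<forall>c. \<forall>x\<in>E. (\<lambda>i. c * x i) \<in> E)"

definition quasi_norm_on :: "(nat \<Rightarrow> real) set \<Rightarrow> ((nat \<Rightarrow> real) \<Rightarrow> real) \<Rightarrow> bool" where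
  "quasi_norm_on E N \<longleftrightarrow>
     (\<forall>x\<in>E. 0 \<le> N x) \<and>
     (\<forall>x\<in>E. N x = 0 \<longleftrightarrow> x = (\<lambda>i. 0)) \<and>
     (\<forall>c. \<forall>x\<in>E. N (\<lambda>i. c * x i) = \<bar>c\<bar> * N x) \<and>
     (\<exists>C\<ge>1. \<forall>x\<in>E. \<forall>y\<in>E. N (\<lambda>i. x i + y i) \<le> C * (N x + N y))"

definition complete_quasi_norm_on :: "(nat \<Rightarrow> real) set \<Rightarrow> ((nat \<Rightarrow> real) \<Rightarrow> real) \<Rightarrow> bool" where
  "complete_quasi_norm_on E N \<longleftrightarrow>
     quasi_norm_on E N \<and>
     (\<forall>X. (\<forall>n. X n \<in> E) \<and>
          (\<forall>\<epsilon>>0. \<exists>M. \<forall>m\<ge>M. \<forall>n\<ge>M. N (\<lambda>i. X m i - X n i) < \<epsilon>) \<longrightarrow>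
          (\<exists>x\<in>E. (\<lambda>n. N (\<lambda>i. X n i - x i)) \<longlonglongrightarrow> 0))"

definition quasi_banach_ideal_space :: "(nat \<Rightarrow> real) set \<Rightarrow> ((nat \<Rightarrow> real) \<Rightarrow> real) \<Rightarrow> bool" where
  "quasi_banach_ideal_space E N \<longleftrightarrow>
     seq_subspace E \<and>
     complete_quasi_norm_on E N \<and>
     (\<forall>x. \<forall>y\<in>E. (\<forall>i. \<bar>x i\<bar> \<le> \<bar>y i\<bar>) \<longrightarrow> x \<in> E \<and> N x \<le> N y) \<and>
     (\<exists>x\<in>E. \<forall>i. 0 < x i)"

definition fatou_property :: "(nat \<Rightarrow> real) set \<Rightarrow> ((nat \<Rightarrow> real) \<Rightarrow> real) \<Rightarrow> bool" where
  "fatou_property E N \<longleftrightarrow>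
     (\<forall>X x. (\<forall>n. X n \<in> E) \<and>
            (\<forall>n i. 0 \<le> X n i) \<and>
            (\<forall>i. incseq (\<lambda>n. X n i) \<and> (\<lambda>n. X n i) \<longlonglongrightarrow> \<bar>x i\<bar>) \<and>
            bdd_above (range (\<lambda>n. N (X n))) \<longrightarrow>
            x \<in> E \<and> (\<lambda>n. N (X n)) \<longlonglongrightarrow> N x)"

definition l_infinity :: "(nat \<Rightarrow> real) set" where
  "l_infinity = {z. Bseq z}"

definition l_infinity_norm :: "(nat \<Rightarrow> real) \<Rightarrow> real" where
  "l_infinity_norm z = (SUP i. \<bar>z i\<bar>)"

text \<open>
  A function \<open>[0,\<infinity>) \<rightarrow> [0,\<infinity>]\<close> is encoded as \<^typ>\<open>real \<Rightarrow> ennreal\<close>; its values at negative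
  arguments are never used.
\<close>

definition b_orlicz :: "(real \<Rightarrow> ennreal) \<Rightarrow> ereal" where
  "b_orlicz \<phi> = (SUP u\<in>{u. 0 \<le> u \<and> \<phi> u < \<infinity>}. ereal u)"

definition a_orlicz :: "(real \<Rightarrow> ennreal) \<Rightarrow> ereal" where
  "a_orlicz \<phi> = (SUP u\<in>{u. 0 \<le> u \<and> \<phi> u = 0}. ereal u)"

text \<open>
  For \<^term>\<open>b_orlicz \<phi> = \<infinity>\<close>, left continuity at \<open>b\<^sub>\<phi>\<close> amounts to the limit condition at infinity.
\<close>

definition orlicz_function :: "(real \<Rightarrow> ennreal) \<Rightarrow> bool" where
  "orlicz_function \<phi> \<longleftrightarrow>
     mono_on {0..} \<phi> \<and>
     \<phi> 0 = 0 \<and>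
     continuous (at_right 0) \<phi> \<and>
     continuous_on {u. 0 < u \<and> ereal u < b_orlicz \<phi>} \<phi> \<and>
     (\<forall>b. b_orlicz \<phi> = ereal b \<longrightarrow> continuous (at_left b) \<phi>) \<and>
     (\<phi> \<longlongrightarrow> \<infinity>) at_top"

definition delta2_infinity :: "(real \<Rightarrow> ennreal) \<Rightarrow> bool" where
  "delta2_infinity \<phi> \<longleftrightarrow>
     (\<exists>K>0. \<exists>u\<^sub>0>0. \<phi> u\<^sub>0 < \<infinity> \<and> (\<forall>u\<ge>u\<^sub>0. \<phi> (2 * u) \<le> ennreal K * \<phi> u))"

definition alpha_all :: "(real \<Rightarrow> ennreal) \<Rightarrow> ereal" where
  "alpha_all \<phi> = (SUP p\<in>{p. \<exists>K\<ge>1. \<forall>u\<ge>0. \<forall>a. 0 < a \<and> a \<le> 1 \<longrightarrow>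
                              \<phi> (a * u) \<le> ennreal (K * a powr p) * \<phi> u}. ereal p)"

definition alpha_infinity :: "(real \<Rightarrow> ennreal) \<Rightarrow> ereal" where
  "alpha_infinity \<phi> = (SUP p\<in>{p. \<exists>K\<ge>1. \<exists>u\<^sub>0>0. \<phi> u\<^sub>0 < \<infinity> \<and>
                              (\<forall>u\<ge>u\<^sub>0. \<forall>a. 0 < a \<and> a \<le> 1 \<longrightarrow>
                                 \<phi> (a * u) \<le> ennreal (K * a powr p) * \<phi> u)}. ereal p)"

text \<open>The index of \<open>\<phi>\<close> relative to \<open>E\<close>, for sequence spaces \<open>E\<close> not contained in \<^const>\<open>l_infinity\<close>.\<close>

definition alpha_ideal :: "(nat \<Rightarrow> real) set \<Rightarrow> (real \<Rightarrow> ennreal) \<Rightarrow> ereal" where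
  "alpha_ideal E \<phi> = (if l_infinity \<subseteq> E then alpha_infinity \<phi> else alpha_all \<phi>)"

text \<open>
  Membership of \<open>\<phi>(|x|)\<close> in \<open>E\<close> includes finiteness of all its coordinates, since \<open>E\<close> consists of
  real sequences.
\<close>

definition rho :: "(nat \<Rightarrow> real) set \<Rightarrow> ((nat \<Rightarrow> real) \<Rightarrow> real) \<Rightarrow> (real \<Rightarrow> ennreal) \<Rightarrow>
    (nat \<Rightarrow> real) \<Rightarrow> ennreal" where
  "rho E N \<phi> x =
     (if (\<forall>i. \<phi> \<bar>x i\<bar> < \<infinity>) \<and> (\<lambda>i. enn2real (\<phi> \<bar>x i\<bar>)) \<in> E
      then ennreal (N (\<lambda>i. enn2real (\<phi> \<bar>x i\<bar>))) else \<infinity>)"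

definition calderon_lozanovskii :: "(nat \<Rightarrow> real) set \<Rightarrow> ((nat \<Rightarrow> real) \<Rightarrow> real) \<Rightarrow>
    (real \<Rightarrow> ennreal) \<Rightarrow> (nat \<Rightarrow> real) set" where
  "calderon_lozanovskii E N \<phi> = {x. \<exists>c>0. rho E N \<phi> (\<lambda>i. c * x i) < \<infinity>}"

text \<open>
  The infimum is taken in \<^typ>\<open>ennreal\<close>, so that the infimum of the empty set is \<open>\<infinity>\<close>.
\<close>

definition luxemburg_norm :: "(nat \<Rightarrow> real) set \<Rightarrow> ((nat \<Rightarrow> real) \<Rightarrow> real) \<Rightarrow>
    (real \<Rightarrow> ennreal) \<Rightarrow> (nat \<Rightarrow> real) \<Rightarrow> ennreal" where
  "luxemburg_norm E N \<phi> x = (INF c\<in>{c. 0 < c \<and> rho E N \<phi> (\<lambda>i. x i / c) \<le> 1}. ennreal c)"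

definition contains_order_isometric_l_infinity ::
    "(nat \<Rightarrow> real) set \<Rightarrow> ((nat \<Rightarrow> real) \<Rightarrow> ennreal) \<Rightarrow> bool" where
  "contains_order_isometric_l_infinity F G \<longleftrightarrow>
     (\<exists>P :: (nat \<Rightarrow> real) \<Rightarrow> (nat \<Rightarrow> real).
        (\<forall>z\<in>l_infinity. P z \<in> F) \<and>
        (\<forall>z\<in>l_infinity. \<forall>w\<in>l_infinity. P (\<lambda>i. z i + w i) = (\<lambda>i. P z i + P w i)) \<and>
        (\<forall>c. \<forall>z\<in>l_infinity. P (\<lambda>i. c * z i) = (\<lambda>i. c * P z i)) \<and>
        (\<forall>z\<in>l_infinity. G (P z) = ennreal (l_infinity_norm z)) \<and>
        (\<forall>z\<in>l_infinity. (\<lambda>i. \<bar>P z i\<bar>) = P (\<lambda>i. \<bar>z i\<bar>)))"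

definition unit_seq :: "nat \<Rightarrow> nat \<Rightarrow> real" where
  "unit_seq i = (\<lambda>k. if k = i then 1 else 0)"

end

theory Submission
  imports Defs
begin

text \<open>
  The copy of \<open>l\<^sub>\<infinity>\<close> is spanned by a disjoint sequence of functions whose supremum stays in the unit
  ball although every one of them already has Luxemburg norm one. It suffices to find coordinates
  \<open>i 0, i 1, \<dots>\<close> and numbers \<open>u k \<ge> 0\<close> such that the sequence with value \<open>u k\<close> at \<open>i k\<close> has modular at
  most \<open>1\<close>, whereas for every \<open>l > 1\<close> the single atom \<open>l u k\<close> at \<open>i k\<close> has modular greater than \<open>1\<close> for
  all large \<open>k\<close>. Cutting the index set into infinitely many infinite blocks, and letting the \<open>m\<close>-th
  coordinate of \<open>z\<close> multiply the \<open>m\<close>-th block, gives the embedding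
  (\<open>contains_l_infinity_of_critical_atoms\<close>).

  When \<open>b\<^sub>\<phi> < \<infinity>\<close>, let \<open>u k\<close> increase to \<open>b\<^sub>\<phi>\<close>. An unbounded element of the unit ball of \<open>E\<close> has
  coordinates at which it dominates the prescribed numbers \<open>\<phi> (u k)\<close>, so the modular is at most \<open>1\<close>;
  and \<open>l u k\<close> eventually exceeds \<open>b\<^sub>\<phi>\<close>, where \<open>\<phi>\<close> is infinite.

  When \<open>b\<^sub>\<phi> = \<infinity>\<close>, failure of \<open>\<Delta>\<^sub>2(\<infinity>)\<close> means that \<open>\<phi> ((1 + \<epsilon>) u) > K \<phi> u\<close> has arbitrarily large
  solutions \<open>u\<close>, for every \<open>\<epsilon>\<close> and \<open>K\<close> (\<open>not_delta2_infinity_jump\<close>). Since the norms of the given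
  unit vectors tend to \<open>0\<close> and no step shrinks them by a factor below \<open>d\<close>, some unit vector brings \<open>\<phi> u\<close> times its
  norm into \<open>(d c, c]\<close> for a prescribed small \<open>c\<close>; with \<open>K\<close> at least \<open>1 / (d c)\<close>, enlarging \<open>u\<close> by the
  factor \<open>1 + \<epsilon>\<close> pushes the product above \<open>1\<close> (\<open>critical_atom\<close>). With \<open>c\<close> running through a geometric
  sequence that beats the quasi-triangle constant, the Fatou property bounds the modular of the sum
  (\<open>geometric_spread\<close>).
\<close>

section \<open>Sequences supported on a range of coordinates\<close>

definition spread :: "(nat \<Rightarrow> nat) \<Rightarrow> (nat \<Rightarrow> real) \<Rightarrow> nat \<Rightarrow> real" where
  "spread i w = (\<lambda>n. if n \<in> range i then w (inv i n) else 0)"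

lemma spread_apply: "inj i \<Longrightarrow> spread i w (i k) = w k"
  by (simp add: spread_def)

lemma spread_outside: "n \<notin> range i \<Longrightarrow> spread i w n = 0"
  by (simp add: spread_def)

section \<open>The modular of an ideal space\<close>

locale quasi_banach_ideal =
  fixes E :: "(nat \<Rightarrow> real) set" and N :: "(nat \<Rightarrow> real) \<Rightarrow> real"
  assumes space: "quasi_banach_ideal_space E N"
begin

lemma zero_mem: "(\<lambda>n. 0) \<in> E"
  and add_mem: "x \<in> E \<Longrightarrow> y \<in> E \<Longrightarrow> (\<lambda>n. x n + y n) \<in> E"
  and scale_mem: "x \<in> E \<Longrightarrow> (\<lambda>n. c * x n) \<in> E"
  using space by (auto simp: quasi_banach_ideal_space_def seq_subspace_def)

lemma quasi_norm: "quasi_norm_on E N"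
  using space by (simp add: quasi_banach_ideal_space_def complete_quasi_norm_on_def)

lemma norm_nonneg: "x \<in> E \<Longrightarrow> 0 \<le> N x"
  and norm_eq_0_iff: "x \<in> E \<Longrightarrow> N x = 0 \<longleftrightarrow> x = (\<lambda>n. 0)"
  and norm_scale: "x \<in> E \<Longrightarrow> N (\<lambda>n. c * x n) = \<bar>c\<bar> * N x"
  using quasi_norm by (auto simp: quasi_norm_on_def)

lemma quasi_triangle:
  obtains C where "1 \<le> C" "\<And>x y. x \<in> E \<Longrightarrow> y \<in> E \<Longrightarrow> N (\<lambda>n. x n + y n) \<le> C * (N x + N y)"
  using quasi_norm by (auto simp: quasi_norm_on_def)

lemma ideal_mem: "y \<in> E \<Longrightarrow> (\<And>n. \<bar>x n\<bar> \<le> \<bar>y n\<bar>) \<Longrightarrow> x \<in> E"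
  and ideal_norm_le: "y \<in> E \<Longrightarrow> (\<And>n. \<bar>x n\<bar> \<le> \<bar>y n\<bar>) \<Longrightarrow> N x \<le> N y"
  using space unfolding quasi_banach_ideal_space_def by blast+

lemma unit_seq_mem: "unit_seq i \<in> E"
proof -
  obtain x where x: "x \<in> E" "\<And>n. 0 < x n"
    using space unfolding quasi_banach_ideal_space_def by blast
  show ?thesis
    by (rule ideal_mem[OF scale_mem[OF x(1), of "1 / x i"]])
      (use x(2) in \<open>auto simp: unit_seq_def less_imp_neq[symmetric]\<close>)
qed

lemma unit_seq_norm_pos: "0 < N (unit_seq i)"
proof -
  have "unit_seq i i \<noteq> 0" by (simp add: unit_seq_def)
  then have "unit_seq i \<noteq> (\<lambda>n. 0)" by metis
  then show ?thesis
    using norm_nonneg[OF unit_seq_mem, of i] norm_eq_0_iff[OF unit_seq_mem, of i] by linarith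
qed

lemma rho_le:
  assumes "w \<in> E" "\<And>n. 0 \<le> w n" "\<And>n. \<phi> \<bar>x n\<bar> \<le> ennreal (w n)"
  shows "rho E N \<phi> x \<le> ennreal (N w)"
proof -
  have fin: "\<phi> \<bar>x n\<bar> < \<infinity>" for n
    using assms(3)[of n] by (simp add: le_less_trans)
  have le: "\<bar>enn2real (\<phi> \<bar>x n\<bar>)\<bar> \<le> \<bar>w n\<bar>" for n
    using enn2real_mono[OF assms(3)[of n]] assms(2)[of n] by simp
  show ?thesis
    using fin ideal_mem[OF assms(1) le] ideal_norm_le[OF assms(1) le]
    by (simp add: rho_def ennreal_leI)
qed

lemma rho_mono:
  assumes "mono_on {0..} \<phi>" "\<And>n. \<bar>x n\<bar> \<le> \<bar>y n\<bar>"
  shows "rho E N \<phi> x \<le> rho E N \<phi> y"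
proof (cases "(\<forall>n. \<phi> \<bar>y n\<bar> < \<infinity>) \<and> (\<lambda>n. enn2real (\<phi> \<bar>y n\<bar>)) \<in> E")
  case True
  have "\<phi> \<bar>x n\<bar> \<le> ennreal (enn2real (\<phi> \<bar>y n\<bar>))" for n
    using True mono_onD[OF assms(1), of "\<bar>x n\<bar>" "\<bar>y n\<bar>"] assms(2) by simp
  then show ?thesis
    using rho_le[of "\<lambda>n. enn2real (\<phi> \<bar>y n\<bar>)" \<phi> x] True by (simp add: rho_def)
next
  case False
  then have "rho E N \<phi> y = \<infinity>" unfolding rho_def by (rule if_not_P)
  then show ?thesis by simp
qed

lemma rho_atom_ge:
  assumes "ennreal c \<le> \<phi> u" "0 \<le> c" "0 \<le> u"
  shows "ennreal (c * N (unit_seq i)) \<le> rho E N \<phi> (\<lambda>n. u * unit_seq i n)"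
proof (cases "(\<forall>n. \<phi> \<bar>u * unit_seq i n\<bar> < \<infinity>) \<and> (\<lambda>n. enn2real (\<phi> \<bar>u * unit_seq i n\<bar>)) \<in> E")
  case True
  then have "\<phi> \<bar>u * unit_seq i i\<bar> < \<infinity>" by blast
  then have "\<phi> u < \<infinity>" using assms(3) by (simp add: unit_seq_def)
  then have "c \<le> enn2real (\<phi> u)"
    using enn2real_mono[OF assms(1)] assms(2) by simp
  then have "\<bar>c * unit_seq i n\<bar> \<le> \<bar>enn2real (\<phi> \<bar>u * unit_seq i n\<bar>)\<bar>" for n
    using assms(2,3) by (simp add: unit_seq_def)
  then have "N (\<lambda>n. c * unit_seq i n) \<le> N (\<lambda>n. enn2real (\<phi> \<bar>u * unit_seq i n\<bar>))"
    using True by (intro ideal_norm_le) auto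
  then show ?thesis
    using True assms(2) norm_scale[OF unit_seq_mem, of c i] by (simp add: rho_def ennreal_leI)
next
  case False
  then have "rho E N \<phi> (\<lambda>n. u * unit_seq i n) = \<infinity>" unfolding rho_def by (rule if_not_P)
  then show ?thesis by simp
qed

section \<open>Embedding \<open>l\<^sub>\<infinity>\<close> along critical atoms\<close>

text \<open>
  The blocks are the fibres of \<open>fst \<circ> prod_decode\<close>; each is infinite, so each block inherits the
  property that dilation by any \<open>l > 1\<close> makes the modular exceed \<open>1\<close>, and thus has norm one. The upper
  bound on norms comes from the joint modular of all blocks.
\<close>

lemma contains_l_infinity_of_critical_atoms:
  assumes mono: "mono_on {0..} \<phi>" and inj: "inj i" and u: "\<And>k. 0 \<le> u k"
    and small: "rho E N \<phi> (spread i u) \<le> 1"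
    and large: "\<And>l. 1 < l \<Longrightarrow> \<exists>k\<^sub>0. \<forall>k\<ge>k\<^sub>0. 1 < rho E N \<phi> (\<lambda>n. (l * u k) * unit_seq (i k) n)"
  shows "contains_order_isometric_l_infinity
           (calderon_lozanovskii E N \<phi>) (luxemburg_norm E N \<phi>)"
proof -
  define P where "P z = spread i (\<lambda>k. z (fst (prod_decode k)) * u k)" for z :: "nat \<Rightarrow> real"
  have P_at: "P z (i k) = z (fst (prod_decode k)) * u k" for z k
    using inj by (simp add: P_def spread_apply)
  have P_out: "n \<notin> range i \<Longrightarrow> P z n = 0" for z n
    by (simp add: P_def spread_outside)
  have coord: "\<bar>z m\<bar> \<le> l_infinity_norm z" if "z \<in> l_infinity" for z m
  proof -
    have "bdd_above (range (\<lambda>m. \<bar>z m\<bar>))"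
      using that by (force simp: l_infinity_def Bseq_def intro: bdd_aboveI)
    then show ?thesis
      unfolding l_infinity_norm_def by (rule cSUP_upper[OF UNIV_I])
  qed
  have nn: "0 \<le> l_infinity_norm z" if "z \<in> l_infinity" for z
    using coord[OF that, of 0] by linarith
  have upper: "rho E N \<phi> (\<lambda>n. P z n / c) \<le> 1"
    if z: "z \<in> l_infinity" and c: "l_infinity_norm z \<le> c" "0 < c" for z c
  proof -
    have le: "\<bar>P z n / c\<bar> \<le> \<bar>spread i u n\<bar>" for n
    proof (cases "n \<in> range i")
      case True
      then obtain k where n: "n = i k" by blast
      have "\<bar>z (fst (prod_decode k))\<bar> * u k \<le> c * u k"
        using coord[OF z, of "fst (prod_decode k)"] c u by (intro mult_right_mono) auto
      then show ?thesis
        using u[of k] c inj by (simp add: n P_at spread_apply abs_mult field_simps)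
    qed (simp add: P_out)
    show ?thesis by (rule order_trans[OF rho_mono[OF mono le] small])
  qed
  have lower: "l_infinity_norm z \<le> c"
    if z: "z \<in> l_infinity" and c: "0 < c" "rho E N \<phi> (\<lambda>n. P z n / c) \<le> 1" for z c
  proof (rule ccontr)
    assume "\<not> l_infinity_norm z \<le> c"
    then have "\<exists>m. c < \<bar>z m\<bar>"
      unfolding l_infinity_norm_def by (meson UNIV_not_empty cSUP_least not_le)
    then obtain m where m: "c < \<bar>z m\<bar>" by blast
    define l where "l = \<bar>z m\<bar> / c"
    have "1 < l" using m c by (simp add: l_def)
    then obtain k\<^sub>0 where k\<^sub>0: "\<And>k. k \<ge> k\<^sub>0 \<Longrightarrow> 1 < rho E N \<phi> (\<lambda>n. (l * u k) * unit_seq (i k) n)"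
      using large by blast
    define k where "k = prod_encode (m, k\<^sub>0)"
    have k: "k\<^sub>0 \<le> k" "fst (prod_decode k) = m"
      by (simp_all add: k_def le_prod_encode_2)
    have le: "\<bar>(l * u k) * unit_seq (i k) n\<bar> \<le> \<bar>P z n / c\<bar>" for n
      using c u[of k] k by (simp add: unit_seq_def P_at l_def abs_mult)
    have "rho E N \<phi> (\<lambda>n. (l * u k) * unit_seq (i k) n) \<le> 1"
      by (rule order_trans[OF rho_mono[OF mono le] c(2)])
    with k\<^sub>0[OF k(1)] show False by (simp add: not_less[symmetric])
  qed
  have mem: "P z \<in> calderon_lozanovskii E N \<phi>" if z: "z \<in> l_infinity" for z
  proof -
    define c where "c = l_infinity_norm z + 1"
    have c: "0 < c" "l_infinity_norm z \<le> c" using nn[OF z] by (simp_all add: c_def)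
    have "rho E N \<phi> (\<lambda>n. (1 / c) * P z n) < \<infinity>"
      using upper[OF z c(2,1)] by (simp add: le_less_trans)
    then show ?thesis
      unfolding calderon_lozanovskii_def using c(1) by (intro CollectI exI[of _ "1 / c"]) simp
  qed
  have norm: "luxemburg_norm E N \<phi> (P z) = ennreal (l_infinity_norm z)" if z: "z \<in> l_infinity" for z
  proof (rule antisym)
    \<comment> \<open>Only positive \<open>c\<close> compete, so for \<open>z = 0\<close> the infimum \<open>0\<close> is not attained.\<close>
    show "luxemburg_norm E N \<phi> (P z) \<le> ennreal (l_infinity_norm z)"
    proof (rule ennreal_le_epsilon)
      fix e :: real assume e: "0 < e"
      have "luxemburg_norm E N \<phi> (P z) \<le> ennreal (l_infinity_norm z + e)"
        unfolding luxemburg_norm_def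
        using upper[OF z, of "l_infinity_norm z + e"] nn[OF z] e by (intro INF_lower) auto
      then show "luxemburg_norm E N \<phi> (P z) \<le> ennreal (l_infinity_norm z) + ennreal e"
        using nn[OF z] e by (simp add: ennreal_plus)
    qed
    show "ennreal (l_infinity_norm z) \<le> luxemburg_norm E N \<phi> (P z)"
      unfolding luxemburg_norm_def using lower[OF z] by (intro INF_greatest ennreal_leI) auto
  qed
  have "P (\<lambda>n. z n + w n) = (\<lambda>n. P z n + P w n)" for z w
    by (auto simp: P_def spread_def algebra_simps)
  moreover have "P (\<lambda>n. c * z n) = (\<lambda>n. c * P z n)" for c z
    by (auto simp: P_def spread_def)
  moreover have "(\<lambda>n. \<bar>P z n\<bar>) = P (\<lambda>n. \<bar>z n\<bar>)" for z
    using u by (auto simp: P_def spread_def abs_mult)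
  ultimately show ?thesis
    unfolding contains_order_isometric_l_infinity_def using mem norm by (intro exI[of _ P]) blast
qed

section \<open>Orlicz functions with a finite bound\<close>

lemma contains_l_infinity_if_bounded_domain:
  assumes unbounded: "E - l_infinity \<noteq> {}" and mono: "mono_on {0..} \<phi>" and zero: "\<phi> 0 = 0"
    and b: "b_orlicz \<phi> = ereal b" "0 < b"
  shows "contains_order_isometric_l_infinity
           (calderon_lozanovskii E N \<phi>) (luxemburg_norm E N \<phi>)"
proof -
  have fin: "\<phi> v < \<infinity>" if "0 \<le> v" "v < b" for v
  proof -
    have "ereal v < b_orlicz \<phi>" using that b by simp
    then obtain t where "0 \<le> t" "\<phi> t < \<infinity>" "v < t"
      unfolding b_orlicz_def by (auto simp: less_SUP_iff)
    then show ?thesis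
      using mono_onD[OF mono, of v t] that by (auto intro: le_less_trans)
  qed
  have inf: "\<phi> v = \<infinity>" if "b < v" for v
  proof (rule ccontr)
    assume "\<phi> v \<noteq> \<infinity>"
    then have "ereal v \<le> b_orlicz \<phi>"
      unfolding b_orlicz_def using that b(2) by (intro SUP_upper) (auto simp: top.not_eq_extremum)
    then show False using that b by simp
  qed
  obtain y where y: "y \<in> E" "y \<notin> l_infinity" using unbounded by blast
  define w where "w n = \<bar>(1 / (N y + 1)) * y n\<bar>" for n
  have s: "0 < N y + 1" using norm_nonneg[OF y(1)] by linarith
  have w: "w \<in> E" and w_norm: "N w \<le> 1"
  proof -
    note m = scale_mem[OF y(1), of "1 / (N y + 1)"]
    show "w \<in> E" by (rule ideal_mem[OF m]) (simp add: w_def)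
    have "N w \<le> N (\<lambda>n. (1 / (N y + 1)) * y n)"
      by (rule ideal_norm_le[OF m]) (simp add: w_def)
    also have "\<dots> \<le> 1" using s by (simp only: norm_scale[OF y(1)]) (simp add: abs_if field_simps)
    finally show "N w \<le> 1" .
  qed
  have w_large: "\<exists>n>J. B < w n" for B J
  proof (rule ccontr)
    assume "\<not> ?thesis"
    then have tail: "\<And>n. J < n \<Longrightarrow> w n \<le> B" by (meson not_less)
    have "Bseq (\<lambda>n. y (n + Suc J))"
    proof (rule BseqI')
      fix n show "norm (y (n + Suc J)) \<le> B * (N y + 1)"
        using tail[of "n + Suc J"] s by (simp add: w_def abs_mult field_simps)
    qed
    then show False using y(2) Bseq_offset[of y "Suc J"] by (simp add: l_infinity_def)
  qed
  define u where "u k = b * (1 - 1 / real (k + 2))" for k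
  have u: "0 \<le> u k" "u k < b" for k using b(2) by (simp_all add: u_def field_simps)
  have "\<exists>i. \<forall>k. enn2real (\<phi> (u k)) < w (i k) \<and> i k < i (Suc k)"
  proof (rule dependent_nat_choice)
    show "\<exists>x. enn2real (\<phi> (u 0)) < w x" using w_large by blast
    show "\<exists>y. enn2real (\<phi> (u (Suc n))) < w y \<and> x < y" for x n using w_large by blast
  qed
  then obtain i where i: "\<And>k. enn2real (\<phi> (u k)) < w (i k)" "\<And>k. i k < i (Suc k)" by blast
  have inj: "inj i" using i(2) by (simp add: strict_mono_Suc_iff strict_mono_imp_inj_on)
  show ?thesis
  proof (rule contains_l_infinity_of_critical_atoms[OF mono inj u(1)])
    have "\<phi> \<bar>spread i u n\<bar> \<le> ennreal (w n)" for n
    proof (cases "n \<in> range i")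
      case True
      then obtain k where n: "n = i k" by blast
      have "\<phi> (u k) = ennreal (enn2real (\<phi> (u k)))" using fin[OF u] by simp
      also have "\<dots> \<le> ennreal (w (i k))" using i(1)[of k] by (intro ennreal_leI) simp
      finally show ?thesis using u(1)[of k] by (simp add: n spread_apply[OF inj])
    qed (simp add: spread_outside zero)
    then have "rho E N \<phi> (spread i u) \<le> ennreal (N w)"
      by (intro rho_le[OF w]) (auto simp: w_def)
    also have "\<dots> \<le> 1" using w_norm by (metis ennreal_1 ennreal_leI)
    finally show "rho E N \<phi> (spread i u) \<le> 1" .
  next
    fix l :: real assume l: "1 < l"
    have "(\<lambda>k. l * u k) \<longlonglongrightarrow> l * (b * (1 - 0))"
      unfolding u_def by (intro tendsto_intros LIMSEQ_ignore_initial_segment[OF lim_1_over_n])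
    moreover have "b < l * (b * (1 - 0))" using l b(2) by simp
    ultimately have "\<forall>\<^sub>F k in sequentially. b < l * u k" by (rule order_tendstoD)
    then obtain k\<^sub>0 where k\<^sub>0: "\<And>k. k\<^sub>0 \<le> k \<Longrightarrow> b < l * u k"
      by (auto simp: eventually_sequentially)
    have "1 < rho E N \<phi> (\<lambda>n. (l * u k) * unit_seq (i k) n)" if "k\<^sub>0 \<le> k" for k
    proof -
      have "\<phi> \<bar>(l * u k) * unit_seq (i k) (i k)\<bar> = \<infinity>"
        using inf[OF k\<^sub>0[OF that]] l u(1)[of k] by (simp add: unit_seq_def)
      then have "\<not> (\<forall>n. \<phi> \<bar>(l * u k) * unit_seq (i k) n\<bar> < \<infinity>)" by (metis less_irrefl)
      then have "rho E N \<phi> (\<lambda>n. (l * u k) * unit_seq (i k) n) = \<infinity>"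
        unfolding rho_def by simp
      then show ?thesis by simp
    qed
    then show "\<exists>k\<^sub>0. \<forall>k\<ge>k\<^sub>0. 1 < rho E N \<phi> (\<lambda>n. (l * u k) * unit_seq (i k) n)" by blast
  qed
qed

section \<open>Finite Orlicz functions\<close>

text \<open>
  The ratio \<open>1 / (2 C)\<close> makes the finite blocks telescope from the right: a block starting at \<open>l\<close> has
  quasi-norm at most \<open>r ^ l\<close>, since \<open>C (r ^ (l + 1) + r ^ (l + 1)) = r ^ l\<close>. The Fatou property then
  passes from finite blocks to the whole sequence.
\<close>

lemma geometric_spread:
  assumes fatou: "fatou_property E N" and inj: "inj i" and w: "\<And>k. 0 \<le> w k"
    and C: "1 \<le> C" "\<And>x y. x \<in> E \<Longrightarrow> y \<in> E \<Longrightarrow> N (\<lambda>n. x n + y n) \<le> C * (N x + N y)"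
    and small: "\<And>k. w k * N (unit_seq (i k)) \<le> (1 / (2 * C)) ^ Suc k"
  shows "spread i w \<in> E" "N (spread i w) \<le> 1"
proof -
  define r where "r = 1 / (2 * C)"
  have r: "0 \<le> r" "C * (r + r) = 1" using C(1) by (simp_all add: r_def)
  define T where "T l m = spread i (\<lambda>k. if l \<le> k \<and> k < l + m then w k else 0)" for l m
  have T: "T l m \<in> E \<and> N (T l m) \<le> r ^ l" for l m
  proof (induction m arbitrary: l)
    case 0
    have "T l 0 = (\<lambda>n. 0)" by (auto simp: T_def spread_def)
    then show ?case
      using zero_mem norm_eq_0_iff[OF zero_mem] r by simp
  next
    case (Suc m)
    have T_Suc: "T l (Suc m) = (\<lambda>n. w l * unit_seq (i l) n + T (Suc l) m n)"
    proof
      fix n show "T l (Suc m) n = w l * unit_seq (i l) n + T (Suc l) m n"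
      proof (cases "n \<in> range i")
        case True
        then obtain k where "n = i k" by blast
        then show ?thesis
          using inj_eq[OF inj, of k l] by (auto simp: T_def spread_apply[OF inj] unit_seq_def)
      next
        case False
        then have "n \<noteq> i l" by blast
        with False show ?thesis by (simp add: T_def spread_outside unit_seq_def)
      qed
    qed
    have e: "(\<lambda>n. w l * unit_seq (i l) n) \<in> E" by (rule scale_mem[OF unit_seq_mem])
    have "N (\<lambda>n. w l * unit_seq (i l) n) \<le> r ^ Suc l"
      using small[of l] w[of l] by (simp add: norm_scale[OF unit_seq_mem] r_def)
    then have "N (\<lambda>n. w l * unit_seq (i l) n) + N (T (Suc l) m) \<le> r ^ Suc l + r ^ Suc l"
      using Suc.IH[of "Suc l"] by linarith
    then have "C * (N (\<lambda>n. w l * unit_seq (i l) n) + N (T (Suc l) m)) \<le> C * (r ^ Suc l + r ^ Suc l)"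
      using C(1) by (intro mult_left_mono) auto
    also have "\<dots> = C * (r + r) * r ^ l" by (simp add: algebra_simps)
    also have "\<dots> = r ^ l" using r(2) by simp
    finally have bound: "C * (N (\<lambda>n. w l * unit_seq (i l) n) + N (T (Suc l) m)) \<le> r ^ l" .
    show ?case
      using add_mem[OF e, of "T (Suc l) m"] C(2)[OF e, of "T (Suc l) m"] Suc.IH[of "Suc l"] bound
      unfolding T_Suc by (auto intro: order_trans)
  qed
  have T0: "T 0 m \<in> E" "N (T 0 m) \<le> 1" for m using T[of 0 m] by auto
  have conv: "(\<lambda>m. T 0 m n) \<longlonglongrightarrow> \<bar>spread i w n\<bar>" for n
  proof (rule tendsto_eventually)
    show "\<forall>\<^sub>F m in sequentially. T 0 m n = \<bar>spread i w n\<bar>"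
      using eventually_gt_at_top[of "inv i n"]
      by eventually_elim (auto simp: T_def spread_def w)
  qed
  have "spread i w \<in> E \<and> (\<lambda>m. N (T 0 m)) \<longlonglongrightarrow> N (spread i w)"
  proof (rule fatou[unfolded fatou_property_def, rule_format], intro conjI allI)
    show "T 0 m \<in> E" for m by (rule T0)
    show "0 \<le> T 0 m n" for m n by (simp add: T_def spread_def w)
    show "incseq (\<lambda>m. T 0 m n)" for n by (auto simp: incseq_def T_def spread_def w)
    show "(\<lambda>m. T 0 m n) \<longlonglongrightarrow> \<bar>spread i w n\<bar>" for n by (rule conv)
    show "bdd_above (range (\<lambda>m. N (T 0 m)))" using T0(2) by (intro bdd_aboveI2[of _ _ 1])
  qed
  then show "spread i w \<in> E" "N (spread i w) \<le> 1"
    using T0(2) LIMSEQ_le_const2 by blast+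
qed

end

text \<open>
  If such a jump were missing beyond some \<open>u\<^sub>0\<close>, iterating the inequality until \<open>(1 + \<epsilon>) ^ m \<ge> 2\<close> would
  give the doubling condition with constant \<open>K ^ m\<close>.
\<close>

lemma not_delta2_infinity_jump:
  assumes mono: "mono_on {0..} \<phi>" and fin: "\<And>v. 0 \<le> v \<Longrightarrow> \<phi> v < \<infinity>"
    and not_delta2: "\<not> delta2_infinity \<phi>" and pos: "0 < \<epsilon>" "0 < K" "0 < u\<^sub>0"
  obtains u where "u\<^sub>0 \<le> u" "ennreal K * \<phi> u < \<phi> ((1 + \<epsilon>) * u)"
proof (rule ccontr)
  note jump = that
  assume neg: "\<not> thesis"
  have step: "\<phi> ((1 + \<epsilon>) * u) \<le> ennreal K * \<phi> u" if "u\<^sub>0 \<le> u" for u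
    using neg jump[OF that] by (meson not_le)
  have iter: "\<phi> ((1 + \<epsilon>) ^ m * u) \<le> ennreal (K ^ m) * \<phi> u" if "u\<^sub>0 \<le> u" for m u
  proof (induction m)
    case (Suc m)
    have "1 * u \<le> (1 + \<epsilon>) ^ m * u"
      using that pos by (intro mult_right_mono one_le_power) auto
    then have "\<phi> ((1 + \<epsilon>) * ((1 + \<epsilon>) ^ m * u)) \<le> ennreal K * \<phi> ((1 + \<epsilon>) ^ m * u)"
      using that by (intro step) auto
    also have "\<dots> \<le> ennreal K * (ennreal (K ^ m) * \<phi> u)"
      using Suc.IH by (intro mult_left_mono) auto
    finally show ?case
      using pos by (simp add: ennreal_mult mult.assoc)
  qed simp
  obtain m where m: "2 < (1 + \<epsilon>) ^ m"
    using real_arch_pow[of "1 + \<epsilon>" 2] pos by auto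
  have "\<phi> (2 * u) \<le> ennreal (K ^ m) * \<phi> u" if "u\<^sub>0 \<le> u" for u
  proof -
    have "2 * u \<le> (1 + \<epsilon>) ^ m * u" using that pos m by (intro mult_right_mono) auto
    then have "\<phi> (2 * u) \<le> \<phi> ((1 + \<epsilon>) ^ m * u)"
      using that pos by (intro mono_onD[OF mono]) auto
    also note iter[OF that]
    finally show ?thesis .
  qed
  then have "delta2_infinity \<phi>"
    unfolding delta2_infinity_def using pos fin[of u\<^sub>0]
    by (intro exI[of _ "K ^ m"] conjI exI[of _ u\<^sub>0]) auto
  with not_delta2 show False by contradiction
qed

text \<open>
  The size \<open>u\<close> is taken so large that the atom at position \<open>J\<close> is still too heavy; the first later
  position at which \<open>f u\<close> times the weight drops to \<open>c\<close> or below then loses at most the factor \<open>d\<close>.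
\<close>

lemma critical_atom:
  fixes f :: "real \<Rightarrow> real" and a :: "nat \<Rightarrow> real"
  assumes mono: "\<And>s t. 0 \<le> s \<Longrightarrow> s \<le> t \<Longrightarrow> f s \<le> f t"
    and unbounded: "\<And>B. \<exists>u>0. B < f u"
    and jump: "\<And>\<epsilon> K u\<^sub>0. 0 < \<epsilon> \<Longrightarrow> 0 < K \<Longrightarrow> 0 < u\<^sub>0 \<Longrightarrow> \<exists>u\<ge>u\<^sub>0. K * f u < f ((1 + \<epsilon>) * u)"
    and a: "\<And>j. 0 < a j" "a \<longlonglongrightarrow> 0" "\<And>j. d \<le> a (Suc j) / a j"
    and pos: "0 < d" "0 < \<epsilon>" "0 < c"
  shows "\<exists>u j. J < j \<and> 0 < u \<and> f u * a j \<le> c \<and> 1 < f ((1 + \<epsilon>) * u) * a j"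
proof -
  obtain u\<^sub>0 where u\<^sub>0: "0 < u\<^sub>0" "c / a J < f u\<^sub>0" using unbounded by blast
  obtain u where u: "u\<^sub>0 \<le> u" "(1 / (d * c)) * f u < f ((1 + \<epsilon>) * u)"
    using jump[OF pos(2) _ u\<^sub>0(1), of "1 / (d * c)"] pos by auto
  have "c / a J < f u" using u\<^sub>0 u mono[of u\<^sub>0 u] by linarith
  then have heavy: "c < f u * a J" using a(1)[of J] by (simp add: field_simps)
  have "(\<lambda>j. f u * a j) \<longlonglongrightarrow> f u * 0" by (intro tendsto_intros a)
  then have "\<forall>\<^sub>F j in sequentially. f u * a j < c"
    using pos by (intro order_tendstoD) auto
  then obtain m where m: "\<And>j. m \<le> j \<Longrightarrow> f u * a j < c" by (auto simp: eventually_sequentially)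
  define k where "k = (LEAST k. f u * a (J + k) \<le> c)"
  have light: "f u * a (J + k) \<le> c"
    unfolding k_def by (rule LeastI[of _ m]) (use m[of "J + m"] in simp)
  then have "k \<noteq> 0" using heavy by (metis add_0_right leD)
  then obtain k' where k': "k = Suc k'" by (cases k) auto
  have prev: "c < f u * a (J + k')"
    using not_less_Least[of k' "\<lambda>k. f u * a (J + k) \<le> c"] k' by (simp add: k_def)
  have "0 < f u"
    using prev pos a(1)[of "J + k'"] by (smt (verit) mult_nonpos_nonneg)
  have "d * a (J + k') \<le> a (J + k)"
    using a(3)[of "J + k'"] a(1)[of "J + k'"] by (simp add: k' field_simps)
  then have "f u * (d * a (J + k')) \<le> f u * a (J + k)"
    using \<open>0 < f u\<close> by simp
  moreover have "d * c < d * (f u * a (J + k'))" using prev pos by simp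
  ultimately have "d * c < f u * a (J + k)" by (simp add: mult.left_commute)
  then have "1 < (1 / (d * c)) * f u * a (J + k)" using pos by (simp add: field_simps)
  also have "\<dots> < f ((1 + \<epsilon>) * u) * a (J + k)"
    using u(2) a(1) by (intro mult_strict_right_mono)
  finally show ?thesis
    using light k' u(1) u\<^sub>0(1) by (intro exI[of _ u] exI[of _ "J + k"]) auto
qed

context quasi_banach_ideal
begin

lemma contains_l_infinity_if_not_delta2:
  assumes fatou: "fatou_property E N" and mono: "mono_on {0..} \<phi>" and zero: "\<phi> 0 = 0"
    and lim: "(\<phi> \<longlongrightarrow> \<infinity>) at_top" and fin: "\<And>v. 0 \<le> v \<Longrightarrow> \<phi> v < \<infinity>"
    and not_delta2: "\<not> delta2_infinity \<phi>"
    and d: "0 < d" and p: "strict_mono p"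
    and to_0: "(\<lambda>j. N (unit_seq (p j))) \<longlonglongrightarrow> 0"
    and ratio: "\<And>j. d \<le> N (unit_seq (p (Suc j))) / N (unit_seq (p j))"
  shows "contains_order_isometric_l_infinity
           (calderon_lozanovskii E N \<phi>) (luxemburg_norm E N \<phi>)"
proof -
  define f where "f v = enn2real (\<phi> v)" for v
  have \<phi>_f: "\<phi> v = ennreal (f v)" if "0 \<le> v" for v using fin[OF that] by (simp add: f_def)
  have f_nonneg: "0 \<le> f v" for v by (simp add: f_def)
  have f_mono: "f s \<le> f t" if "0 \<le> s" "s \<le> t" for s t
    unfolding f_def using that fin[of t] mono_onD[OF mono, of s t] by (intro enn2real_mono) auto
  have f_unbounded: "\<exists>u>0. B < f u" for B
  proof -
    have "\<forall>\<^sub>F u in at_top. ennreal \<bar>B\<bar> < \<phi> u" using lim by (rule order_tendstoD) simp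
    then have "\<forall>\<^sub>F u in at_top. ennreal \<bar>B\<bar> < \<phi> u \<and> 0 < u"
      using eventually_gt_at_top by (rule eventually_conj)
    then obtain u where u: "ennreal \<bar>B\<bar> < \<phi> u" "0 < u"
      by (auto dest: eventually_happens'[OF trivial_limit_at_top_linorder])
    then have "\<bar>B\<bar> < f u" using \<phi>_f[of u] by (simp add: ennreal_less_iff)
    with u(2) show ?thesis by (intro exI[of _ u]) auto
  qed
  have f_jump: "\<exists>u\<ge>u\<^sub>0. K * f u < f ((1 + \<epsilon>) * u)" if pos: "0 < \<epsilon>" "0 < K" "0 < u\<^sub>0" for \<epsilon> K u\<^sub>0
  proof -
    obtain u where u: "u\<^sub>0 \<le> u" "ennreal K * \<phi> u < \<phi> ((1 + \<epsilon>) * u)"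
      using not_delta2_infinity_jump[OF mono fin not_delta2 pos] .
    then have "ennreal (K * f u) < ennreal (f ((1 + \<epsilon>) * u))"
      using pos \<phi>_f f_nonneg by (simp add: ennreal_mult)
    then show ?thesis using u(1) pos f_nonneg by (auto simp: ennreal_less_iff)
  qed
  obtain C where C: "1 \<le> C" "\<And>x y. x \<in> E \<Longrightarrow> y \<in> E \<Longrightarrow> N (\<lambda>n. x n + y n) \<le> C * (N x + N y)"
    by (rule quasi_triangle) blast
  define a where "a j = N (unit_seq (p j))" for j
  define good where "good k s \<longleftrightarrow> 0 < fst s \<and> f (fst s) * a (snd s) \<le> (1 / (2 * C)) ^ Suc k \<and>
      1 < f ((1 + 1 / real (Suc k)) * fst s) * a (snd s)" for k and s :: "real \<times> nat"
  have exists_good: "\<exists>s. good k s \<and> J < snd s" for k J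
  proof -
    have "\<exists>u j. J < j \<and> 0 < u \<and> f u * a j \<le> (1 / (2 * C)) ^ Suc k \<and>
        1 < f ((1 + 1 / real (Suc k)) * u) * a j"
      by (rule critical_atom[OF f_mono f_unbounded f_jump _ _ _ d])
        (use C(1) unit_seq_norm_pos to_0 ratio in \<open>auto simp: a_def\<close>)
    then show ?thesis by (auto simp: good_def)
  qed
  have "\<exists>s. \<forall>k. good k (s k) \<and> snd (s k) < snd (s (Suc k))"
  proof (rule dependent_nat_choice)
    show "\<exists>s. good 0 s" using exists_good by blast
    show "\<exists>t. good (Suc k) t \<and> snd s < snd t" for s k using exists_good by blast
  qed
  then obtain s where s: "\<And>k. good k (s k)" "\<And>k. snd (s k) < snd (s (Suc k))" by blast
  define u where "u k = fst (s k)" for k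
  define i where "i k = p (snd (s k))" for k
  have u: "0 \<le> u k"
    and small: "f (u k) * N (unit_seq (i k)) \<le> (1 / (2 * C)) ^ Suc k"
    and large: "1 < f ((1 + 1 / real (Suc k)) * u k) * N (unit_seq (i k))" for k
    using s(1)[of k] by (auto simp: good_def u_def i_def a_def)
  have "strict_mono i"
    using s(2) strict_monoD[OF p] by (simp add: strict_mono_Suc_iff i_def)
  then have inj: "inj i" by (rule strict_mono_imp_inj_on)
  show ?thesis
  proof (rule contains_l_infinity_of_critical_atoms[OF mono inj u])
    note w = geometric_spread[OF fatou inj, of "\<lambda>k. f (u k)", OF f_nonneg C small]
    have "\<phi> \<bar>spread i u n\<bar> \<le> ennreal (spread i (\<lambda>k. f (u k)) n)" for n
      using u \<phi>_f by (auto simp: spread_def zero simp flip: \<phi>_f)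
    then have "rho E N \<phi> (spread i u) \<le> ennreal (N (spread i (\<lambda>k. f (u k))))"
      using f_nonneg by (intro rho_le[OF w(1)]) (simp_all add: spread_def)
    also have "\<dots> \<le> 1" using w(2) by (metis ennreal_1 ennreal_leI)
    finally show "rho E N \<phi> (spread i u) \<le> 1" .
  next
    fix l :: real assume l: "1 < l"
    obtain k\<^sub>0 where k\<^sub>0: "inverse (real (Suc k\<^sub>0)) < l - 1" using reals_Archimedean[of "l - 1"] l by auto
    have "1 < rho E N \<phi> (\<lambda>n. (l * u k) * unit_seq (i k) n)" if "k\<^sub>0 \<le> k" for k
    proof -
      have "1 / real (Suc k) \<le> 1 / real (Suc k\<^sub>0)" using that by (simp add: frac_le)
      then have "(1 + 1 / real (Suc k)) * u k \<le> l * u k"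
        using k\<^sub>0 u[of k] by (intro mult_right_mono) (auto simp: inverse_eq_divide)
      then have "f ((1 + 1 / real (Suc k)) * u k) \<le> f (l * u k)"
        using u[of k] by (intro f_mono) auto
      then have "f ((1 + 1 / real (Suc k)) * u k) * N (unit_seq (i k)) \<le> f (l * u k) * N (unit_seq (i k))"
        using unit_seq_norm_pos[of "i k"] by (intro mult_right_mono) auto
      then have "ennreal 1 < ennreal (f (l * u k) * N (unit_seq (i k)))"
        using large[of k] by (subst ennreal_less_iff) auto
      also have "\<dots> \<le> rho E N \<phi> (\<lambda>n. (l * u k) * unit_seq (i k) n)"
        using u[of k] l \<phi>_f[of "l * u k"] f_nonneg by (intro rho_atom_ge) auto
      finally show ?thesis by simp
    qed
    then show "\<exists>k\<^sub>0. \<forall>k\<ge>k\<^sub>0. 1 < rho E N \<phi> (\<lambda>n. (l * u k) * unit_seq (i k) n)" by blast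
  qed
qed

end

section \<open>The embedding theorem\<close>

theorem theorem5p11:
  fixes E :: "(nat \<Rightarrow> real) set"
    and N :: "(nat \<Rightarrow> real) \<Rightarrow> real"
    and \<phi> :: "real \<Rightarrow> ennreal"
  assumes "quasi_banach_ideal_space E N"
    and "fatou_property E N"
    and "E - l_infinity \<noteq> {}"
    and "orlicz_function \<phi>"
    and "a_orlicz \<phi> < b_orlicz \<phi>"
    and "alpha_ideal E \<phi> > 0"
  shows "(b_orlicz \<phi> < \<infinity> \<longrightarrow>
            contains_order_isometric_l_infinity
              (calderon_lozanovskii E N \<phi>) (luxemburg_norm E N \<phi>)) \<and>
         (b_orlicz \<phi> = \<infinity> \<and>
          (\<exists>(d::real) (i :: nat \<Rightarrow> nat).
             0 < d \<and> d < 1 \<and> strict_mono i \<and>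
             (\<lambda>j. N (unit_seq (i j))) \<longlonglongrightarrow> 0 \<and>
             (\<forall>j. N (unit_seq (i (Suc j))) / N (unit_seq (i j)) \<ge> d)) \<and>
          \<not> delta2_infinity \<phi> \<longrightarrow>
            contains_order_isometric_l_infinity
              (calderon_lozanovskii E N \<phi>) (luxemburg_norm E N \<phi>))"
proof -
  interpret quasi_banach_ideal E N by unfold_locales (rule assms(1))
  have mono: "mono_on {0..} \<phi>" and zero: "\<phi> 0 = 0" and lim: "(\<phi> \<longlongrightarrow> \<infinity>) at_top"
    using assms(4) by (auto simp: orlicz_function_def)
  have "0 \<le> a_orlicz \<phi>"
    unfolding a_orlicz_def using zero by (intro SUP_upper2[of 0]) auto
  with assms(5) have b_pos: "0 < b_orlicz \<phi>" by (rule le_less_trans[rotated])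
  show ?thesis
  proof (intro conjI impI)
    assume "b_orlicz \<phi> < \<infinity>"
    with b_pos obtain b where "b_orlicz \<phi> = ereal b" "0 < b" by (cases "b_orlicz \<phi>") auto
    then show "contains_order_isometric_l_infinity
        (calderon_lozanovskii E N \<phi>) (luxemburg_norm E N \<phi>)"
      using contains_l_infinity_if_bounded_domain[OF assms(3) mono zero] by blast
  next
    assume *: "b_orlicz \<phi> = \<infinity> \<and>
      (\<exists>(d::real) (i :: nat \<Rightarrow> nat).
         0 < d \<and> d < 1 \<and> strict_mono i \<and>
         (\<lambda>j. N (unit_seq (i j))) \<longlonglongrightarrow> 0 \<and>
         (\<forall>j. N (unit_seq (i (Suc j))) / N (unit_seq (i j)) \<ge> d)) \<and>
      \<not> delta2_infinity \<phi>"
    have "\<phi> v < \<infinity>" if "0 \<le> v" for v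
    proof -
      have "ereal v < b_orlicz \<phi>" using * by simp
      then obtain t where "0 \<le> t" "\<phi> t < \<infinity>" "v < t"
        unfolding b_orlicz_def by (auto simp: less_SUP_iff)
      then show ?thesis
        using mono_onD[OF mono, of v t] that by (auto intro: le_less_trans)
    qed
    with * show "contains_order_isometric_l_infinity
        (calderon_lozanovskii E N \<phi>) (luxemburg_norm E N \<phi>)"
      using contains_l_infinity_if_not_delta2[OF assms(2) mono zero lim] by blast
  qed
qed

end
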